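(* For any restriction semifunctor $\mathsf p:\mathbb E\to\mathbb B$ between restriction categories, the following are equivalent: (i) $\mathsf p$ is separated; (ii) all partial isomorphisms in $\mathbb E$ are $\mathsf p$-prone; (iii) all restriction idempotents in $\mathbb E$ are $\mathsf p$-prone.
   Context: Composition is written in diagrammatic order. A restriction category is a category with an operation sending each $f:A\to B$ to $\overline f:A\to A$ such that (R.1) $\overline f f=f$; (R.2) $\overline f\,\overline g=\overline g\,\overline f$ for $f,g$ with the same domain; (R.3) $\overline{\overline f g}=\overline f\,\overline g$ for $f,g$ with the same domain; (R.4) $f\overline g=\overline{fg}\,f$ for composable $f,g$. A restriction idempotent is an endomap $e=\overline e$. A partial isomorphism is a map $s:A\to B$ for which there is $s^{(-1)}:B\to A$ with $ss^{(-1)}=\overline s$ and $s^{(-1)}s=\overline{s^{(-1)}}$. A restriction semifunctor preserves domains, codomains, composition and restriction ($F(\overline f)=\overline{F(f)}$), but not necessarily identities. A restriction semifunctor $\mathsf p:\mathbb E\to\mathbb B$ is separated if for any object $X\in\mathbb E$ and restriction idempotents $e,e'$ on $X$, $\mathsf p(e)=\mathsf p(e')$ implies $e=e'$. A commuting triangle $kf=g$ (with left factor $k$) is precise if $\overline g=\overline k$. An arrow $f':X'\to X$ of $\mathbb E$ is $\mathsf p$-prone if whenever $g:Y\to X$ in $\mathbb E$ and $h:\mathsf p(Y)\to\mathsf p(X')$ in $\mathbb B$ are such that $h\,\mathsf p(f')=\mathsf p(g)$ is precise, there is a unique $\widetilde h:Y\to X'$ with $\mathsf p(\widetilde h)=h$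 and $\widetilde h f'=g$ precise. *)

theory Defs
  imports Main
begin

text \<open>Composition is written in diagrammatic order: \<open>f \<cdot> g\<close> is \<open>f\<close> followed by \<open>g\<close>.
  The operations are total functions on the underlying types; only their values on objects,
  arrows and composable pairs of arrows are meaningful.\<close>

record ('o, 'a) cat =
  Obj :: "'o set"
  Arr :: "'a set"
  Dom :: "'a \<Rightarrow> 'o"
  Cod :: "'a \<Rightarrow> 'o"
  Id :: "'o \<Rightarrow> 'a"
  Comp :: "'a \<Rightarrow> 'a \<Rightarrow> 'a" (infixl "\<cdot>\<index>" 70)

record ('o, 'a) rcat = "('o, 'a) cat" +
  Rst :: "'a \<Rightarrow> 'a"

definition Hom :: "('o, 'a, 'm) cat_scheme \<Rightarrow> 'o \<Rightarrow> 'o \<Rightarrow> 'a set" where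
  "Hom C A B = {f \<in> Arr C. Dom C f = A \<and> Cod C f = B}"

locale category =
  fixes C :: "('o, 'a, 'm) cat_scheme" (structure)
  assumes dom_obj: "f \<in> Arr C \<Longrightarrow> Dom C f \<in> Obj C"
    and cod_obj: "f \<in> Arr C \<Longrightarrow> Cod C f \<in> Obj C"
    and id_hom: "A \<in> Obj C \<Longrightarrow> Id C A \<in> Hom C A A"
    and comp_hom: "\<lbrakk>f \<in> Hom C A B; g \<in> Hom C B D\<rbrakk> \<Longrightarrow> f \<cdot> g \<in> Hom C A D"
    and id_left: "f \<in> Hom C A B \<Longrightarrow> Id C A \<cdot> f = f"
    and id_right: "f \<in> Hom C A B \<Longrightarrow> f \<cdot> Id C B = f"
    and comp_assoc: "\<lbrakk>f \<in> Hom C A B; g \<in> Hom C B D; h \<in> Hom C D E\<rbrakk>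
      \<Longrightarrow> (f \<cdot> g) \<cdot> h = f \<cdot> (g \<cdot> h)"

locale restriction_category = category C
  for C :: "('o, 'a, 'm) rcat_scheme" (structure) +
  assumes rst_hom: "f \<in> Hom C A B \<Longrightarrow> Rst C f \<in> Hom C A A"
    and R1: "f \<in> Hom C A B \<Longrightarrow> Rst C f \<cdot> f = f"
    and R2: "\<lbrakk>f \<in> Hom C A B; g \<in> Hom C A D\<rbrakk> \<Longrightarrow> Rst C f \<cdot> Rst C g = Rst C g \<cdot> Rst C f"
    and R3: "\<lbrakk>f \<in> Hom C A B; g \<in> Hom C A D\<rbrakk> \<Longrightarrow> Rst C (Rst C f \<cdot> g) = Rst C f \<cdot> Rst C g"
    and R4: "\<lbrakk>f \<in> Hom C A B; g \<in> Hom C B D\<rbrakk> \<Longrightarrow> f \<cdot> Rst C g = Rst C (f \<cdot> g) \<cdot> f"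

definition restriction_idempotent :: "('o, 'a, 'm) rcat_scheme \<Rightarrow> 'o \<Rightarrow> 'a \<Rightarrow> bool" where
  "restriction_idempotent C X e \<longleftrightarrow> e \<in> Hom C X X \<and> e = Rst C e"

definition partial_isomorphism :: "('o, 'a, 'm) rcat_scheme \<Rightarrow> 'o \<Rightarrow> 'o \<Rightarrow> 'a \<Rightarrow> bool" where
  "partial_isomorphism C A B s \<longleftrightarrow> s \<in> Hom C A B \<and>
    (\<exists>t \<in> Hom C B A. s \<cdot>\<^bsub>C\<^esub> t = Rst C s \<and> t \<cdot>\<^bsub>C\<^esub> s = Rst C t)"

locale restriction_semifunctor =
  E: restriction_category E + B: restriction_category B
  for E :: "('o, 'a, 'm) rcat_scheme" and B :: "('p, 'b, 'n) rcat_scheme"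
  and p_obj :: "'o \<Rightarrow> 'p" and p_arr :: "'a \<Rightarrow> 'b" +
  assumes map_obj: "X \<in> Obj E \<Longrightarrow> p_obj X \<in> Obj B"
    and map_hom: "f \<in> Hom E X Y \<Longrightarrow> p_arr f \<in> Hom B (p_obj X) (p_obj Y)"
    and map_comp: "\<lbrakk>f \<in> Hom E X Y; g \<in> Hom E Y Z\<rbrakk>
      \<Longrightarrow> p_arr (f \<cdot>\<^bsub>E\<^esub> g) = p_arr f \<cdot>\<^bsub>B\<^esub> p_arr g"
    and map_rst: "f \<in> Hom E X Y \<Longrightarrow> p_arr (Rst E f) = Rst B (p_arr f)"

definition separated ::
  "('o, 'a, 'm) rcat_scheme \<Rightarrow> ('a \<Rightarrow> 'b) \<Rightarrow> bool" where
  "separated E p_arr \<longleftrightarrow> (\<forall>X \<in> Obj E. \<forall>e e'.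
    restriction_idempotent E X e \<longrightarrow> restriction_idempotent E X e' \<longrightarrow>
    p_arr e = p_arr e' \<longrightarrow> e = e')"

definition precise_triangle :: "('o, 'a, 'm) rcat_scheme \<Rightarrow> 'a \<Rightarrow> 'a \<Rightarrow> 'a \<Rightarrow> bool" where
  "precise_triangle C k f g \<longleftrightarrow> k \<cdot>\<^bsub>C\<^esub> f = g \<and> Rst C g = Rst C k"

definition prone ::
  "('o, 'a, 'm) rcat_scheme \<Rightarrow> ('p, 'b, 'n) rcat_scheme \<Rightarrow> ('o \<Rightarrow> 'p) \<Rightarrow> ('a \<Rightarrow> 'b)
    \<Rightarrow> 'o \<Rightarrow> 'o \<Rightarrow> 'a \<Rightarrow> bool" where
  "prone E B p_obj p_arr X' X f' \<longleftrightarrow> f' \<in> Hom E X' X \<and>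
    (\<forall>Y \<in> Obj E. \<forall>g \<in> Hom E Y X. \<forall>h \<in> Hom B (p_obj Y) (p_obj X').
      precise_triangle B h (p_arr f') (p_arr g) \<longrightarrow>
      (\<exists>!h'. h' \<in> Hom E Y X' \<and> p_arr h' = h \<and> precise_triangle E h' f' g))"

end

theory Submission
  imports Defs
begin

text \<open>A lift through a partial isomorphism with partial inverse \<open>t\<close> can only be \<open>g\<close> followed by
  \<open>t\<close>. The triangle it forms commutes once its restriction is that of \<open>g\<close>; the two restrictions have
  the same image, so separatedness makes them equal. Conversely, if \<open>e\<close> and \<open>e'\<close> have the same image,
  lifting along the prone idempotent \<open>e'\<close> factors \<open>e\<close> through \<open>e'\<close>, so \<open>e \<le> e'\<close>, and symmetrically.\<close>

context restriction_category
begin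

lemma restriction_idempotent_comp_self:
  assumes "restriction_idempotent C X e"
  shows "e \<cdot> e = e"
  using R1[of e X X] assms unfolding restriction_idempotent_def by metis

lemma restriction_idempotent_commute:
  assumes "restriction_idempotent C X e" and "restriction_idempotent C X e'"
  shows "e \<cdot> e' = e' \<cdot> e"
  using R2[of e X X e' X] assms unfolding restriction_idempotent_def by metis

text \<open>R3 with the identity as second map: R1 makes the restriction of an identity the identity
  itself.\<close>

lemma Rst_Rst:
  assumes f: "f \<in> Hom C A B"
  shows "Rst C (Rst C f) = Rst C f"
proof -
  have A: "A \<in> Obj C"
    using f dom_obj unfolding Hom_def by blast
  have "Rst C (Rst C f \<cdot> Id C A) = Rst C f \<cdot> Rst C (Id C A)"
    using R3 f id_hom A by blast
  moreover have "Rst C (Id C A) = Id C A"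
    using R1 id_right rst_hom id_hom A by metis
  ultimately show ?thesis
    using id_right rst_hom f by metis
qed

lemma restriction_idempotent_Rst:
  assumes "f \<in> Hom C A B"
  shows "restriction_idempotent C A (Rst C f)"
  using assms rst_hom Rst_Rst unfolding restriction_idempotent_def by metis

text \<open>A restriction idempotent is its own partial inverse.\<close>

lemma restriction_idempotent_imp_partial_isomorphism:
  assumes "restriction_idempotent C X e"
  shows "partial_isomorphism C X X e"
  using assms restriction_idempotent_comp_self[OF assms]
  unfolding restriction_idempotent_def partial_isomorphism_def by metis

text \<open>R4 turns the left side into \<open>Rst C g\<close> followed by \<open>h\<close>;
  preciseness replaces \<open>Rst C g\<close> by \<open>Rst C h\<close>, and R1 concludes. Used in
  \<open>B\<close> to see that the lift lies over \<open>h\<close>, and in \<open>E\<close> for its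
  uniqueness.\<close>

lemma precise_triangle_comp_Rst:
  assumes "h \<in> Hom C A B" and "s \<in> Hom C B D" and "precise_triangle C h s g"
  shows "h \<cdot> Rst C s = h"
  using assms R1 R4 unfolding precise_triangle_def by metis

end

context restriction_semifunctor
begin

lemma separated_imp_prone:
  assumes sep: "separated E p_arr" and iso: "partial_isomorphism E X' X s"
  shows "prone E B p_obj p_arr X' X s"
proof -
  obtain t where s: "s \<in> Hom E X' X" and t: "t \<in> Hom E X X'"
    and st: "s \<cdot>\<^bsub>E\<^esub> t = Rst E s" and ts: "t \<cdot>\<^bsub>E\<^esub> s = Rst E t"
    using iso unfolding partial_isomorphism_def by blast
  have "\<exists>!h'. h' \<in> Hom E Y X' \<and> p_arr h' = h \<and> precise_triangle E h' s g"
    if Y: "Y \<in> Obj E" and g: "g \<in> Hom E Y X" and h: "h \<in> Hom B (p_obj Y) (p_obj X')"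
      and tri: "precise_triangle B h (p_arr s) (p_arr g)" for Y g h
  proof (rule ex1I[of _ "g \<cdot>\<^bsub>E\<^esub> t"], intro conjI)
    show gt: "g \<cdot>\<^bsub>E\<^esub> t \<in> Hom E Y X'"
      using E.comp_hom g t .
    have "p_arr (g \<cdot>\<^bsub>E\<^esub> t) = (h \<cdot>\<^bsub>B\<^esub> p_arr s) \<cdot>\<^bsub>B\<^esub> p_arr t"
      using map_comp[OF g t] tri unfolding precise_triangle_def by simp
    also have "\<dots> = h \<cdot>\<^bsub>B\<^esub> Rst B (p_arr s)"
      using B.comp_assoc[OF h map_hom[OF s] map_hom[OF t]] map_comp[OF s t] map_rst[OF s] st
      by simp
    also have "\<dots> = h"
      using B.precise_triangle_comp_Rst[OF h map_hom[OF s] tri] .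
    finally show p: "p_arr (g \<cdot>\<^bsub>E\<^esub> t) = h" .
    \<comment> \<open>Both sides are the restriction of \<open>h\<close>, the right one because the
      triangle in \<open>B\<close> is precise.\<close>
    have "p_arr (Rst E (g \<cdot>\<^bsub>E\<^esub> t)) = p_arr (Rst E g)"
      using map_rst[OF gt] map_rst[OF g] p tri unfolding precise_triangle_def by simp
    then have rst: "Rst E (g \<cdot>\<^bsub>E\<^esub> t) = Rst E g"
      using sep Y E.restriction_idempotent_Rst[OF gt] E.restriction_idempotent_Rst[OF g]
      unfolding separated_def by blast
    \<comment> \<open>Since \<open>t\<close> followed by \<open>s\<close> is \<open>Rst E t\<close>,
      R4 moves this restriction to the left of \<open>g\<close> as that of the lift, which
      \<open>rst\<close> identifies with \<open>Rst E g\<close>.\<close>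
    have "(g \<cdot>\<^bsub>E\<^esub> t) \<cdot>\<^bsub>E\<^esub> s = g"
      using E.comp_assoc[OF g t s] ts E.R4[OF g t] rst E.R1[OF g] by simp
    with rst show "precise_triangle E (g \<cdot>\<^bsub>E\<^esub> t) s g"
      unfolding precise_triangle_def by simp
  next
    fix k
    assume k: "k \<in> Hom E Y X' \<and> p_arr k = h \<and> precise_triangle E k s g"
    then have "k = k \<cdot>\<^bsub>E\<^esub> (s \<cdot>\<^bsub>E\<^esub> t)"
      using E.precise_triangle_comp_Rst s st by metis
    also have "\<dots> = g \<cdot>\<^bsub>E\<^esub> t"
      using k E.comp_assoc s t unfolding precise_triangle_def by metis
    finally show "k = g \<cdot>\<^bsub>E\<^esub> t" .
  qed
  with s show ?thesis
    unfolding prone_def by blast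
qed

lemma prone_restriction_idempotent_absorbs:
  assumes e: "restriction_idempotent E X e" and e': "restriction_idempotent E X e'"
    and eq: "p_arr e = p_arr e'" and prone: "prone E B p_obj p_arr X X e'"
  shows "e \<cdot>\<^bsub>E\<^esub> e' = e"
proof -
  have hom: "e \<in> Hom E X X" "e' \<in> Hom E X X"
    using e e' unfolding restriction_idempotent_def by auto
  then have X: "X \<in> Obj E"
    using E.dom_obj unfolding Hom_def by blast
  have "p_arr e \<cdot>\<^bsub>B\<^esub> p_arr e' = p_arr e"
    using map_comp[OF hom(1) hom(1)] E.restriction_idempotent_comp_self[OF e] eq by simp
  \<comment> \<open>Left factor and composite coincide, so preciseness is immediate.\<close>
  then have "precise_triangle B (p_arr e) (p_arr e') (p_arr e)"
    unfolding precise_triangle_def by simp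
  then obtain k where k: "k \<in> Hom E X X" and ke': "k \<cdot>\<^bsub>E\<^esub> e' = e"
    using prone X hom(1) map_hom[OF hom(1)] unfolding prone_def precise_triangle_def by blast
  have "e \<cdot>\<^bsub>E\<^esub> e' = k \<cdot>\<^bsub>E\<^esub> (e' \<cdot>\<^bsub>E\<^esub> e')"
    using E.comp_assoc[OF k hom(2) hom(2)] ke' by simp
  then show ?thesis
    using E.restriction_idempotent_comp_self[OF e'] ke' by simp
qed

text \<open>Absorption in both directions and commutation give \<open>e\<close> =
  \<open>e e'\<close> = \<open>e' e\<close> = \<open>e'\<close>.\<close>

lemma prone_restriction_idempotents_imp_separated:
  assumes "\<And>X e. restriction_idempotent E X e \<Longrightarrow> prone E B p_obj p_arr X X e"
  shows "separated E p_arr"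
  unfolding separated_def
  using assms prone_restriction_idempotent_absorbs E.restriction_idempotent_commute by metis

end

theorem proposition4p11:
  fixes E :: "('o, 'a, 'm) rcat_scheme" and B :: "('p, 'b, 'n) rcat_scheme"
    and p_obj :: "'o \<Rightarrow> 'p" and p_arr :: "'a \<Rightarrow> 'b"
  assumes "restriction_semifunctor E B p_obj p_arr"
  shows "(separated E p_arr \<longleftrightarrow>
      (\<forall>X Y s. partial_isomorphism E X Y s \<longrightarrow> prone E B p_obj p_arr X Y s)) \<and>
    ((\<forall>X Y s. partial_isomorphism E X Y s \<longrightarrow> prone E B p_obj p_arr X Y s) \<longleftrightarrow>
      (\<forall>X e. restriction_idempotent E X e \<longrightarrow> prone E B p_obj p_arr X X e))"
proof -
  interpret restriction_semifunctor E B p_obj p_arr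
    using assms .
  show ?thesis
    \<comment> \<open>These close the cycle (i) to (ii) to (iii) to (i).\<close>
    using separated_imp_prone prone_restriction_idempotents_imp_separated
      E.restriction_idempotent_imp_partial_isomorphism by blast
qed

end
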